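(* For all $n\ge 1$, the polynomial $W_n(q,t):=\sum_{\sigma\in\mathcal{W}^*_{2n+1}} q^{\mathrm{art}(\sigma)} t^{\mathrm{des}(\sigma)}$ can be expanded as \[ W_n(q,t)=\sum_{j=0}^{\lfloor n/2\rfloor} \gamma_{n,j}(q)\, t^j(1+t)^{n-2j},\qquad \gamma_{n,j}(q)=\sum_{\sigma} q^{\mathrm{art}(\sigma)}, \] where the sum defining $\gamma_{n,j}(q)$ runs over all primary odd-odd-descent permutations $\sigma\in\mathcal{W}^*_{2n+1}$ with $j$ descents. Moreover, setting $\gamma_{0,0}(q)=1$, \[ \sum_{n\ge 0}\Big(\sum_{j=0}^{\lfloor n/2\rfloor} \gamma_{n,j}(q) t^j \Big)x^n=\cfrac{1}{1-\mu_0 x-\cfrac{\lambda_1 x^2}{1-\mu_1 x-\cfrac{\lambda_2 x^2}{1-\mu_2 x-\cdots}}}, \] where $\mu_h=[h+1]_q^2$ for $h\ge 0$ and $\lambda_h=[h]_q^2[h+1]_q^2\,t$ for $h\ge 1$.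
   Context: $[k]_q=1+q+\cdots+q^{k-1}$. For $\sigma=\sigma_1\cdots\sigma_n\in\mathfrak{S}_n$ (permutations of $[n]$), a descent is an index $i\in[n-1]$ with $\sigma_i>\sigma_{i+1}$ (descent pair $(\sigma_i,\sigma_{i+1})$), and $\mathrm{des}(\sigma)$ is the number of descents. A descent pair is odd-odd if both entries are odd. $\mathcal{W}_n$ is the set of $\sigma\in\mathfrak{S}_n$ all of whose descent pairs are odd-odd, and $\mathcal{W}^*_{2n+1}$ is the set of $\sigma\in\mathcal{W}_{2n+1}$ whose last entry $\sigma_{2n+1}$ is odd. With the convention $\sigma_0=\sigma_{n+1}=0$, the entry $\sigma_i$ ($1\le i\le n$) is a peak if $\sigma_{i-1}<\sigma_i>\sigma_{i+1}$, a valley if $\sigma_{i-1}>\sigma_i<\sigma_{i+1}$, a double descent if $\sigma_{i-1}>\sigma_i>\sigma_{i+1}$, a double ascent if $\sigma_{i-1}<\sigma_i<\sigma_{i+1}$. For $i\in[n]$ let $v(i)$ (resp. $p(i)$) be the number of valleys (resp. peaks) of $\sigma$ that are less than $i$ and located to the left of the entry $i$ in $\sigma$; define $\mathrm{art}(\sigma)=\sum_{i=1}^n (v(i)-p(i))$. A permutation $\sigma\in\mathcal{W}^*_{2n+1}$ is a primary odd-odd-descent permutation if $\sigma$ has no double descent and $\sigma_{2n}<\sigma_{2n+1}$. *)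

theory Defs
  imports "HOL-Combinatorics.Multiset_Permutations" "HOL-Computational_Algebra.Formal_Power_Series"
begin

(* A permutation sigma of [m] is a list of length m (sigma_i = sigma ! (i-1)).
   ent sigma i is sigma_i for 1 <= i <= m, with the convention sigma_0 = sigma_(m+1) = 0. *)
definition ent :: "nat list \<Rightarrow> nat \<Rightarrow> nat" where
  "ent s i = (if 1 \<le> i \<and> i \<le> length s then s ! (i - 1) else 0)"

definition descents :: "nat list \<Rightarrow> nat set" where
  "descents s = {i \<in> {1..<length s}. ent s i > ent s (Suc i)}"

definition des :: "nat list \<Rightarrow> nat" where
  "des s = card (descents s)"

definition odd_odd_desc :: "nat list \<Rightarrow> bool" where
  "odd_odd_desc s = (\<forall>i \<in> descents s. odd (ent s i) \<and> odd (ent s (Suc i)))"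

definition Wset :: "nat \<Rightarrow> nat list set" where
  "Wset m = {s \<in> permutations_of_set {1..m}. odd_odd_desc s}"

definition Wstar :: "nat \<Rightarrow> nat list set" where
  "Wstar n = {s \<in> Wset (2*n+1). odd (ent s (2*n+1))}"

definition is_peak :: "nat list \<Rightarrow> nat \<Rightarrow> bool" where
  "is_peak s i = (1 \<le> i \<and> i \<le> length s \<and> ent s (i-1) < ent s i \<and> ent s i > ent s (Suc i))"

definition is_valley :: "nat list \<Rightarrow> nat \<Rightarrow> bool" where
  "is_valley s i = (1 \<le> i \<and> i \<le> length s \<and> ent s (i-1) > ent s i \<and> ent s i < ent s (Suc i))"

definition is_double_descent :: "nat list \<Rightarrow> nat \<Rightarrow> bool" where
  "is_double_descent s i = (1 \<le> i \<and> i \<le> length s \<and> ent s (i-1) > ent s i \<and> ent s i > ent s (Suc i))"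

definition vcount :: "nat list \<Rightarrow> nat \<Rightarrow> nat" where
  "vcount s k = card {j. is_valley s j \<and> ent s j < k \<and>
                        (\<exists>i \<in> {1..length s}. ent s i = k \<and> j < i)}"

definition pcount :: "nat list \<Rightarrow> nat \<Rightarrow> nat" where
  "pcount s k = card {j. is_peak s j \<and> ent s j < k \<and>
                        (\<exists>i \<in> {1..length s}. ent s i = k \<and> j < i)}"

definition art :: "nat list \<Rightarrow> int" where
  "art s = (\<Sum>k = 1..length s. int (vcount s k) - int (pcount s k))"

definition primary :: "nat \<Rightarrow> nat list \<Rightarrow> bool" where
  "primary n s = (s \<in> Wstar n \<and> (\<forall>i. \<not> is_double_descent s i) \<and>
                  ent s (2*n) < ent s (2*n+1))"

definition Wpoly :: "'a::field \<Rightarrow> 'a \<Rightarrow> nat \<Rightarrow> 'a" where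
  "Wpoly q t n = (\<Sum>s \<in> Wstar n. q powi art s * t ^ des s)"

definition gam :: "'a::field \<Rightarrow> nat \<Rightarrow> nat \<Rightarrow> 'a" where
  "gam q n j = (\<Sum>s \<in> {s \<in> Wstar n. primary n s \<and> des s = j}. q powi art s)"

definition qint :: "'a::field \<Rightarrow> nat \<Rightarrow> 'a" where
  "qint q k = (\<Sum>i<k. q ^ i)"

definition mu :: "'a::field \<Rightarrow> nat \<Rightarrow> 'a" where
  "mu q h = (qint q (h+1))^2"

definition lam :: "'a::field \<Rightarrow> 'a \<Rightarrow> nat \<Rightarrow> 'a" where
  "lam q t h = (qint q h)^2 * (qint q (h+1))^2 * t"

fun cfrac :: "'a::field \<Rightarrow> 'a \<Rightarrow> nat \<Rightarrow> nat \<Rightarrow> 'a fps" where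
  "cfrac q t h 0 = 0"
| "cfrac q t h (Suc d) =
     inverse (1 - fps_const (mu q h) * fps_X
                - fps_const (lam q t (Suc h)) * fps_X ^ 2 * cfrac q t (Suc h) d)"

end

(* Build a permutation of 1..2n+1 by inserting the values in increasing order, keeping a word in which
   0 marks every gap that larger values will fill.  A new value replaces a gap by itself together with a
   new gap on its left and/or right; the four cases are valley, double descent, double ascent and peak.
   A value put into the gap with i gaps to its left contributes i to art, so with g gaps the choice of
   the gap contributes [g]_q.  The permutation is in Wstar iff all even values are double ascents, so
   inserting the pair 2i-1, 2i is a step of a Motzkin path at height h = g - 1 with level weight
   (1+t)[h+1]^2, or just [h+1]^2 without double descents, and with product t[h+1]^2[h+2]^2 for an up step
   and the matching down step.  Both claims are read off these path sums. *)
theory Submission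
  imports Defs
begin

section \<open>Words with gaps, as truncations of permutations\<close>

text \<open>The letter 0 marks a gap, that is, a maximal block of entries exceeding \<open>k\<close>.\<close>

definition trunc :: "nat \<Rightarrow> nat list \<Rightarrow> nat list" where
  "trunc k s = remdups_adj (map (\<lambda>x. if x \<le> k then x else 0) s)"

text \<open>Since the nonzero letters are distinct, \<open>distinct_adj\<close> says that no two
  gaps touch.\<close>

definition gap_words :: "nat \<Rightarrow> nat list set" where
  "gap_words k = {w. distinct_adj w \<and> filter (\<lambda>x. x \<noteq> 0) w \<in> permutations_of_set {1..k}}"

lemma remdups_adj_map_remdups_adj:
  "remdups_adj (map f (remdups_adj xs)) = remdups_adj (map f xs)"
proof (induction xs rule: remdups_adj.induct)
  case (3 x y xs)
  show ?case
  proof (cases "x = y")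
    case True
    then show ?thesis using 3 by simp
  next
    case False
    then have "remdups_adj (map f (remdups_adj (x # y # xs)))
        = remdups_adj (f x # map f (remdups_adj (y # xs)))" by simp
    also have "\<dots> = remdups_adj (f x # map f (y # xs))"
      using 3(2)[OF False] by (simp only: remdups_adj_Cons)
    finally show ?thesis by simp
  qed
qed auto

text \<open>Only the letters satisfying \<open>P\<close> have to be distinct, so gaps may repeat:
  merging them loses no nonzero letter.\<close>

lemma filter_remdups_adj:
  "distinct (filter P xs) \<Longrightarrow> filter P (remdups_adj xs) = filter P xs"
  by (induction xs rule: remdups_adj.induct) (auto split: if_splits)

text \<open>Makes the truncations of a permutation a chain, so that values can be inserted one by
  one.\<close>

lemma trunc_trunc: "j \<le> k \<Longrightarrow> trunc j (trunc k s) = trunc j s"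
  unfolding trunc_def remdups_adj_map_remdups_adj
  by (simp add: comp_def) (rule arg_cong[where f = remdups_adj], auto)

text \<open>Truncation keeps \<open>k\<close>, which occurs once and differs from 0, so no letters
  merge across it.\<close>

lemma trunc_split:
  assumes "k \<notin> set u" "k \<notin> set v" "k > 0"
  shows "trunc k (u @ k # v) = trunc k u @ k # trunc k v"
proof -
  let ?f = "\<lambda>x. if x \<le> k then x else 0"
  have u: "k \<notin> set (map ?f u)" and v: "k \<notin> set (map ?f v)"
    using assms by auto
  have "remdups_adj (map ?f u @ k # map ?f v)
      = remdups_adj (map ?f u) @ remdups_adj (k # map ?f v)"
    using u by (intro remdups_adj_append') (metis last_in_set list.sel(1))
  moreover have "remdups_adj ([k] @ map ?f v) = remdups_adj [k] @ remdups_adj (map ?f v)"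
    using v by (intro remdups_adj_append') (metis hd_in_set last.simps)
  ultimately show ?thesis by (simp add: trunc_def)
qed

lemma trunc_in_gap_words:
  assumes "s \<in> permutations_of_set {1..n}" "k \<le> n"
  shows "trunc k s \<in> gap_words k"
proof -
  let ?f = "\<lambda>x. if x \<le> k then x else 0"
  have s: "set s = {1..n}" "distinct s" using assms permutations_of_setD by blast+
  have eq: "filter (\<lambda>x. x \<noteq> 0) (map ?f s') = filter (\<lambda>x. x \<le> k) s'" if "0 \<notin> set s'" for s'
    using that by (induction s') auto
  have f: "filter (\<lambda>x. x \<noteq> 0) (map ?f s) = filter (\<lambda>x. x \<le> k) s"
    using s by (intro eq) auto
  have "filter (\<lambda>x. x \<noteq> 0) (trunc k s) = filter (\<lambda>x. x \<le> k) s"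
    unfolding trunc_def using f s filter_remdups_adj[of "\<lambda>x. x \<noteq> 0" "map ?f s"] by simp
  then show ?thesis
    using s assms(2) by (auto simp: gap_words_def trunc_def intro!: permutations_of_setI)
qed

section \<open>Choosing a gap and inserting the next value\<close>

definition qn :: "'b::comm_ring_1 \<Rightarrow> nat \<Rightarrow> 'b" where
  "qn q k = (\<Sum>i<k. q ^ i)"

lemma qn_simps [simp]: "qn q 0 = 0" "qn q (Suc 0) = 1"
  by (simp_all add: qn_def)

lemma qn_Suc: "qn q (Suc k) = 1 + q * qn q k"
  unfolding qn_def sum.lessThan_Suc_shift by (simp add: sum_distrib_left)

definition gaps :: "nat list \<Rightarrow> (nat list \<times> nat list) set" where
  "gaps w = {(a, b). w = a @ 0 # b}"

lemma gaps_Nil: "gaps [] = {}"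
  by (auto simp: gaps_def)

lemma gaps_Cons:
  "gaps (x # w) = (if x = 0 then {([], w)} else {}) \<union> (\<lambda>(a, b). (x # a, b)) ` gaps w"
  by (auto simp: gaps_def Cons_eq_append_conv image_iff)

lemma finite_gaps [simp]: "finite (gaps w)"
  by (induction w) (auto simp: gaps_Nil gaps_Cons)

text \<open>From left to right, the gaps of \<open>w\<close> have 0, 1, 2, ... gaps before
  them.\<close>

lemma sum_gaps: "(\<Sum>(a, b) \<in> gaps w. q ^ count_list a 0) = qn q (count_list w 0)"
proof (induction w)
  case (Cons x w)
  have inj: "inj_on (\<lambda>(a, b). (x # a, b)) (gaps w)"
    by (auto simp: inj_on_def)
  have "(\<Sum>(a, b) \<in> gaps (x # w). q ^ count_list a 0)
     = (\<Sum>(a, b) \<in> (if x = 0 then {([], w)} else {}). q ^ count_list a 0)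
       + (\<Sum>(a, b) \<in> (\<lambda>(a, b). (x # a, b)) ` gaps w. q ^ count_list a 0)"
    unfolding gaps_Cons by (subst sum.union_disjoint) auto
  also have "(\<Sum>(a, b) \<in> (\<lambda>(a, b). (x # a, b)) ` gaps w. q ^ count_list a 0)
     = (\<Sum>(a, b) \<in> gaps w. (if x = 0 then q else 1) * q ^ count_list a 0)"
    unfolding sum.reindex[OF inj] by (intro sum.cong) auto
  also have "\<dots> = (if x = 0 then q else 1) * qn q (count_list w 0)"
    unfolding Cons[symmetric] sum_distrib_left by (intro sum.cong) auto
  finally show ?case by (auto simp: qn_Suc)
qed (simp add: gaps_Nil)

text \<open>\<open>L\<close> and \<open>R\<close> tell on which sides of \<open>k\<close> a gap
  remains: both for a valley, only \<open>L\<close> for a double descent, only \<open>R\<close> for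
  a double ascent, neither for a peak.\<close>

definition fill :: "nat \<Rightarrow> (nat list \<times> nat list) \<times> bool \<times> bool \<Rightarrow> nat list" where
  "fill k = (\<lambda>((a, b), L, R). a @ (if L then [0] else []) @ k # (if R then [0] else []) @ b)"

lemma gap_wordsD:
  assumes "w \<in> gap_words k"
  shows "distinct_adj w" "set (filter (\<lambda>x. x \<noteq> 0) w) = {1..k}" "distinct (filter (\<lambda>x. x \<noteq> 0) w)"
proof -
  have "distinct_adj w" and f: "filter (\<lambda>x. x \<noteq> 0) w \<in> permutations_of_set {1..k}"
    using assms unfolding gap_words_def by blast+
  then show "distinct_adj w" by blast
  show "set (filter (\<lambda>x. x \<noteq> 0) w) = {1..k}" "distinct (filter (\<lambda>x. x \<noteq> 0) w)"
    by (rule permutations_of_setD[OF f])+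
qed

lemma gap_words_letters:
  assumes "w \<in> gap_words k" "x \<in> set w"
  shows "x \<le> k"
proof (cases "x = 0")
  case False
  then have "x \<in> set (filter (\<lambda>x. x \<noteq> 0) w)" using assms(2) by simp
  then show ?thesis unfolding gap_wordsD(2)[OF assms(1)] by simp
qed simp

text \<open>Truncation turns an inserted value and the gaps beside it into a run of zeros; this
  collapses the run to the gap that had been filled.\<close>

lemma remdups_adj_merge:
  assumes "distinct_adj (a @ x # b)"
  shows "remdups_adj (a @ x # replicate n x @ b) = a @ x # b"
proof -
  have b: "dropWhile (\<lambda>y. y = x) b = b"
    using assms by (cases b) (auto simp: distinct_adj_append_iff)
  have ax: "distinct_adj (a @ [x])" and bb: "distinct_adj b"
    using assms by (auto simp: distinct_adj_append_iff dest: distinct_adj_ConsD)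
  have "dropWhile (\<lambda>y. y = x) (replicate n x @ b) = b"
    using b by (induction n) auto
  then show ?thesis
    using ax bb unfolding remdups_adj_append_dropWhile[of a x "replicate n x @ b"]
    by (simp add: distinct_adj_altdef)
qed

lemma trunc_fill:
  assumes "w \<in> gap_words k" "(a, b) \<in> gaps w"
  shows "trunc k (fill (Suc k) ((a, b), L, R)) = w"
proof -
  let ?f = "\<lambda>x. if x \<le> k then x else 0"
  have w: "w = a @ 0 # b" using assms(2) by (auto simp: gaps_def)
  have le: "x \<le> k" if "x \<in> set a \<union> set b" for x
    using gap_words_letters[OF assms(1)] that w by auto
  have "map ?f a = a" "map ?f b = b"
    using le by (simp_all add: map_idI)
  then have "map ?f (fill (Suc k) ((a, b), L, R)) 
      = a @ 0 # replicate (of_bool L + of_bool R) 0 @ b"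
    by (auto simp: fill_def numeral_2_eq_2)
  then have "trunc k (fill (Suc k) ((a, b), L, R)) 
      = remdups_adj (a @ 0 # replicate (of_bool L + of_bool R) 0 @ b)"
    unfolding trunc_def by (rule arg_cong)
  also have "\<dots> = a @ 0 # b"
    using assms(1) w by (intro remdups_adj_merge) (simp add: gap_words_def)
  finally show ?thesis using w by simp
qed

lemma fill_in_gap_words:
  assumes "w \<in> gap_words k" "(a, b) \<in> gaps w"
  shows "fill (Suc k) ((a, b), L, R) \<in> gap_words (Suc k)"
proof -
  have w: "w = a @ 0 # b" using assms(2) by (auto simp: gaps_def)
  have k: "Suc k \<notin> set a" "Suc k \<notin> set b" 
    using gap_words_letters[OF assms(1)] w by fastforce+
  have d: "distinct_adj (a @ 0 # b)" using assms(1) w by (auto simp: gap_words_def)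
  have "a = [] \<or> last a \<noteq> Suc k" "b = [] \<or> hd b \<noteq> Suc k"
    using k by (metis last_in_set, metis hd_in_set)
  then have "distinct_adj (fill (Suc k) ((a, b), L, R))"
    using d by (auto simp: fill_def distinct_adj_append_iff distinct_adj_Cons)
  moreover have "filter (\<lambda>x. x \<noteq> 0) (a @ b) \<in> permutations_of_set {1..k}"
    using assms(1) w by (auto simp: gap_words_def)
  then have "filter (\<lambda>x. x \<noteq> 0) (fill (Suc k) ((a, b), L, R)) \<in> permutations_of_set {1..Suc k}"
    using k unfolding permutations_of_set_def
    by (auto simp: fill_def atLeastAtMostSuc_conv)
  ultimately show ?thesis by (simp add: gap_words_def)
qed

text \<open>The word splits uniquely at \<open>Suc k\<close>. No other gap touches the filled one,
  so a 0 next to \<open>Suc k\<close> determines \<open>L\<close> or \<open>R\<close>.\<close>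

lemma inj_on_fill:
  assumes "w \<in> gap_words k"
  shows "inj_on (fill (Suc k)) (gaps w \<times> UNIV)"
proof (rule inj_onI)
  fix x y assume "x \<in> gaps w \<times> UNIV" "y \<in> gaps w \<times> UNIV"
    and xy: "fill (Suc k) x = fill (Suc k) y"
  then obtain a b L R a' b' L' R' where x: "x = ((a, b), L, R)" and y: "y = ((a', b'), L', R')"
    and g: "(a, b) \<in> gaps w" "(a', b') \<in> gaps w"
    by auto
  have eq: "fill (Suc k) ((a, b), L, R) = fill (Suc k) ((a', b'), L', R')"
    using xy x y by simp
  have w: "w = a @ 0 # b" "w = a' @ 0 # b'" using g by (auto simp: gaps_def)
  have k: "Suc k \<notin> set a" "Suc k \<notin> set a'" "Suc k \<notin> set b"
  proof -
    have "Suc k \<notin> set w" using gap_words_letters[OF assms, of "Suc k"] by auto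
    then have "Suc k \<notin> set (a @ 0 # b)" "Suc k \<notin> set (a' @ 0 # b')"
      using w by auto
    then show "Suc k \<notin> set a" "Suc k \<notin> set a'" "Suc k \<notin> set b" by auto
  qed
  have d: "distinct_adj (a @ 0 # b)" "distinct_adj (a' @ 0 # b')"
    using assms w by (auto simp: gap_words_def)
  then have z: "a = [] \<or> last a \<noteq> 0" "b = [] \<or> hd b \<noteq> 0" "a' = [] \<or> last a' \<noteq> 0" 
      "b' = [] \<or> hd b' \<noteq> 0"
    by (auto simp: distinct_adj_append_iff distinct_adj_Cons)
  have "(a @ (if L then [0] else [])) @ Suc k # (if R then [0] else []) @ b
      = (a' @ (if L' then [0] else [])) @ Suc k # (if R' then [0] else []) @ b'"
    using eq by (simp add: fill_def)
  then have "a @ (if L then [0] else []) = a' @ (if L' then [0] else []) \<and>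
      (if R then [0] else []) @ b = (if R' then [0] else []) @ b'"
    by (subst (asm) append_Cons_eq_iff) (use k in auto)
  then show "x = y"
    using z unfolding x y by (auto split: if_splits)
qed

text \<open>Together with \<open>inj_on_fill\<close>, this parametrises the successors of
  \<open>w\<close> by a gap and one of four cases.\<close>

lemma gap_words_eq_fill:
  assumes "w \<in> gap_words k"
  shows "{w' \<in> gap_words (Suc k). trunc k w' = w} = fill (Suc k) ` (gaps w \<times> UNIV)"
proof (intro equalityI subsetI)
  fix w' assume "w' \<in> fill (Suc k) ` (gaps w \<times> UNIV)"
  then show "w' \<in> {w' \<in> gap_words (Suc k). trunc k w' = w}"
    using assms trunc_fill fill_in_gap_words by auto
next
  fix w' assume "w' \<in> {w' \<in> gap_words (Suc k). trunc k w' = w}"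
  then have w': "w' \<in> gap_words (Suc k)" and t: "trunc k w' = w" by auto
  let ?P = "filter (\<lambda>x. x \<noteq> 0)"
  have fp: "set (?P w') = {1..Suc k}" "distinct (?P w')"
    using gap_wordsD[OF w'] by auto
  have "Suc k \<in> set (?P w')" using fp by simp
  then have "Suc k \<in> set w'" by simp
  then obtain u v where uv: "w' = u @ Suc k # v" "Suc k \<notin> set u" by (meson split_list_first)
  have v: "Suc k \<notin> set v" using fp(2) uv by simp
  have d: "distinct_adj (u @ Suc k # v)" using w' uv by (simp add: gap_words_def)
  \<comment> \<open>The zeros next to \<open>Suc k\<close> give \<open>L\<close> and
    \<open>R\<close>; removing them from \<open>u\<close> and \<open>v\<close> leaves the two sides
    of the filled gap.\<close>
  define L where "L \<longleftrightarrow> u \<noteq> [] \<and> last u = 0"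
  define R where "R \<longleftrightarrow> v \<noteq> [] \<and> hd v = 0"
  obtain a where a: "u = a @ (if L then [0] else [])" "a = [] \<or> last a \<noteq> 0"
  proof (cases L)
    case True
    then have "u = butlast u @ [0]" by (metis L_def append_butlast_last_id)
    moreover then have "butlast u = [] \<or> last (butlast u) \<noteq> 0"
      using d by (metis distinct_adj_append_iff distinct_adj_appendD1 list.distinct(1) list.sel(1))
    ultimately show ?thesis using that True by metis
  qed (use that L_def in auto)
  obtain b where b: "v = (if R then [0] else []) @ b" "b = [] \<or> hd b \<noteq> 0"
  proof (cases R)
    case True
    then obtain b where b: "v = 0 # b" by (metis R_def list.collapse)
    then have "b = [] \<or> hd b \<noteq> 0"
      using d by (auto simp: distinct_adj_append_iff distinct_adj_Cons)
    then show ?thesis using that[of b] b True by auto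
  qed (use that R_def in auto)
  have da: "distinct_adj a" using d a by (metis distinct_adj_appendD1)
  have db: "distinct_adj b" using d b 
    by (metis distinct_adj_ConsD distinct_adj_appendD2)
  have dab: "distinct_adj (a @ 0 # b)"
    using da db a b by (auto simp: distinct_adj_append_iff distinct_adj_Cons)
  have le: "x \<le> k" if "x \<in> set a \<union> set b" for x
    using gap_words_letters[OF w', of x] that uv v a b by (force simp: le_Suc_eq)
  let ?f = "\<lambda>x. if x \<le> k then x else 0"
  have "map ?f a = a" "map ?f b = b"
    using le by (auto intro!: map_idI)
  moreover have wf: "w' = fill (Suc k) ((a, b), L, R)"
    using uv a b by (simp add: fill_def)
  ultimately have "map ?f w' = a @ 0 # replicate (of_bool L + of_bool R) 0 @ b"
    by (auto simp: fill_def numeral_2_eq_2)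
  then have "w = a @ 0 # b" using t dab by (auto simp: trunc_def remdups_adj_merge)
  then show "w' \<in> fill (Suc k) ` (gaps w \<times> UNIV)"
    using wf by (auto simp: gaps_def)
qed

section \<open>Weights of insertions and their sums over all completions\<close>

text \<open>\<open>t\<close> marks values that will be the lower entry of a descent,
  \<open>e\<close> marks double descents, and even values are forced to be double ascents.\<close>

definition local_weight :: "'b::comm_ring_1 \<Rightarrow> 'b \<Rightarrow> nat \<Rightarrow> bool \<Rightarrow> bool \<Rightarrow> 'b" where
  "local_weight t e k L R =
     (if even k then of_bool (\<not> L \<and> R) else t ^ of_bool L * e ^ of_bool (L \<and> \<not> R))"

text \<open>Reads the insertion of \<open>k\<close> off the resulting word. If \<open>L\<close>
  holds, the last gap of \<open>u\<close> is a remainder of the filled gap, so it is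
  subtracted.\<close>

definition value_weight :: "'b::comm_ring_1 \<Rightarrow> 'b \<Rightarrow> 'b \<Rightarrow> nat \<Rightarrow> nat list \<Rightarrow> 'b" where
  "value_weight q t e k w =
     (let u = takeWhile (\<lambda>x. x \<noteq> k) w; v = tl (dropWhile (\<lambda>x. x \<noteq> k) w);
          L = (u \<noteq> [] \<and> last u = 0); R = (v \<noteq> [] \<and> hd v = 0)
      in q ^ (count_list u 0 - of_bool L) * local_weight t e k L R)"

lemma value_weight_split:
  assumes "k \<notin> set u"
  shows "value_weight q t e k (u @ k # v) =
     q ^ (count_list u 0 - of_bool (u \<noteq> [] \<and> last u = 0)) *
     local_weight t e k (u \<noteq> [] \<and> last u = 0) (v \<noteq> [] \<and> hd v = 0)"
proof -
  have "takeWhile (\<lambda>x. x \<noteq> k) (u @ k # v) = u" "dropWhile (\<lambda>x. x \<noteq> k) (u @ k # v) = k # v"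
    using assms by (induction u) auto
  then show ?thesis by (simp add: value_weight_def)
qed

lemma value_weight_fill:
  assumes "w \<in> gap_words k" "(a, b) \<in> gaps w"
  shows "value_weight q t e (Suc k) (fill (Suc k) ((a, b), L, R)) =
     q ^ count_list a 0 * local_weight t e (Suc k) L R"
proof -
  have w: "w = a @ 0 # b" using assms(2) by (auto simp: gaps_def)
  have "Suc k \<notin> set w" using gap_words_letters[OF assms(1), of "Suc k"] by auto
  then have k: "Suc k \<notin> set (a @ (if L then [0] else []))" using w by auto
  have z: "a = [] \<or> last a \<noteq> 0" "b = [] \<or> hd b \<noteq> 0"
    using gap_wordsD(1)[OF assms(1)] w by (auto simp: distinct_adj_append_iff distinct_adj_Cons)
  have "fill (Suc k) ((a, b), L, R)
      = (a @ (if L then [0] else [])) @ Suc k # (if R then [0] else []) @ b"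
    by (simp add: fill_def)
  then have "value_weight q t e (Suc k) (fill (Suc k) ((a, b), L, R)) =
      value_weight q t e (Suc k)
        ((a @ (if L then [0] else [])) @ Suc k # (if R then [0] else []) @ b)"
    by (rule arg_cong)
  also have "\<dots> = q ^ count_list a 0 * local_weight t e (Suc k) L R"
    unfolding value_weight_split[OF k] using z by (cases L; cases R) auto
  finally show ?thesis .
qed

text \<open>The choice of the gap gives \<open>qn q g\<close>. A valley adds a gap, a peak removes
  one, and the other two cases keep their number.\<close>

lemma sum_successors:
  assumes w: "w \<in> gap_words k"
  defines "g \<equiv> count_list w 0"
  shows "(\<Sum>w' | w' \<in> gap_words (Suc k) \<and> trunc k w' = w.
            value_weight q t e (Suc k) w' * f (count_list w' 0)) =
         qn q g * (if even (Suc k) then f g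
                   else t * f (g + 1) + (1 + t * e) * f g + f (g - 1))"
proof -
  define c where "c = (\<lambda>(L, R). local_weight t e (Suc k) L R * f (g - 1 + of_bool L + of_bool R))"
  have "(\<Sum>w' | w' \<in> gap_words (Suc k) \<and> trunc k w' = w.
            value_weight q t e (Suc k) w' * f (count_list w' 0))
     = (\<Sum>x \<in> gaps w \<times> UNIV. value_weight q t e (Suc k) (fill (Suc k) x)
            * f (count_list (fill (Suc k) x) 0))"
    unfolding gap_words_eq_fill[OF w] by (subst sum.reindex[OF inj_on_fill[OF w]]) simp
  also have "\<dots> = (\<Sum>(p, d) \<in> gaps w \<times> UNIV. (case p of (a, b) \<Rightarrow> q ^ count_list a 0) * c d)"
  proof (intro sum.cong refl, clarify)
    fix a b L R assume ab: "(a, b) \<in> gaps w"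
    then have "w = a @ 0 # b" by (auto simp: gaps_def)
    then have "count_list (fill (Suc k) ((a, b), L, R)) 0 = g - 1 + of_bool L + of_bool R"
      by (auto simp: fill_def g_def)
    then show "value_weight q t e (Suc k) (fill (Suc k) ((a, b), L, R))
            * f (count_list (fill (Suc k) ((a, b), L, R)) 0) = q ^ count_list a 0 * c (L, R)"
      by (simp add: value_weight_fill[OF w ab] c_def mult.assoc)
  qed
  also have "\<dots> = qn q g * sum c UNIV"
    unfolding sum.cartesian_product[symmetric] g_def sum_gaps[symmetric] sum_product by simp
  also have "sum c UNIV = c (True, True) + c (True, False) + c (False, True) + c (False, False)"
    by (simp add: UNIV_bool flip: UNIV_Times_UNIV)
  also have "qn q g * \<dots> = qn q g * (if even (Suc k) then f g
                   else t * f (g + 1) + (1 + t * e) * f g + f (g - 1))"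
  \<comment> \<open>For \<open>g = 0\<close> the factor \<open>qn q g\<close> vanishes, which makes
    the truncated \<open>g - 1\<close> harmless.\<close>
  proof (cases g)
    case (Suc m)
    then show ?thesis by (auto simp: c_def local_weight_def algebra_simps)
  qed simp
  finally show ?thesis .
qed

text \<open>The argument \<open>r\<close> counts the values still to be inserted, so the value being inserted is
  \<open>N - r\<close> in the second equation.\<close>

fun completion_sum :: "'b::comm_ring_1 \<Rightarrow> 'b \<Rightarrow> 'b \<Rightarrow> nat \<Rightarrow> nat \<Rightarrow> nat \<Rightarrow> 'b" where
  "completion_sum q t e N 0 g = of_bool (g = 0)"
| "completion_sum q t e N (Suc r) g = qn q g *
     (if even (N - r) then completion_sum q t e N r g
      else t * completion_sum q t e N r (g + 1) + (1 + t * e) * completion_sum q t e N r g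
           + completion_sum q t e N r (g - 1))"

lemma trunc_permutation:
  assumes "s \<in> permutations_of_set {1..n}"
  shows "trunc n s = s"
proof -
  have s: "set s = {1..n}" "distinct s" using permutations_of_setD[OF assms] .
  then have "map (\<lambda>x. if x \<le> n then x else 0) s = s" by (intro map_idI) auto
  then show ?thesis using s(2) by (simp add: trunc_def remdups_adj_distinct)
qed

text \<open>Completions are grouped by their next truncation. By \<open>sum_successors\<close>, only
  the number of gaps of \<open>w\<close> matters.\<close>

lemma sum_completions:
  assumes "k \<le> N" "w \<in> gap_words k"
  shows "(\<Sum>s | s \<in> permutations_of_set {1..N} \<and> trunc k s = w.
            \<Prod>j = Suc k..N. value_weight q t e j (trunc j s))
          = completion_sum q t e N (N - k) (count_list w 0)"
  using assms
proof (induction k arbitrary: w rule: inc_induct)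
  case base
  \<comment> \<open>With all values inserted, a word is a permutation exactly if it has no gap
    left.\<close>
  have "{s \<in> permutations_of_set {1..N}. trunc N s = w} = (if count_list w 0 = 0 then {w} else {})"
  proof (cases "count_list w 0 = 0")
    case True
    then have "filter (\<lambda>x. x \<noteq> 0) w = w"
      by (intro filter_True) (metis count_list_0_iff)
    then have "w \<in> permutations_of_set {1..N}" using base unfolding gap_words_def by simp
    then show ?thesis using True trunc_permutation by auto
  next
    case False
    then have "0 \<in> set w" by (metis count_list_0_iff)
    moreover have "0 \<notin> set s" if "s \<in> permutations_of_set {1..N}" for s
      using permutations_of_setD[OF that] by simp
    ultimately show ?thesis using False trunc_permutation by auto
  qed
  then show ?case by simp
next
  case (step k)
  let ?P = "{s \<in> permutations_of_set {1..N}. trunc k s = w}"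
  let ?T = "{w' \<in> gap_words (Suc k). trunc k w' = w}"
  let ?h = "\<lambda>k s. \<Prod>j = Suc k..N. value_weight q t e j (trunc j s)"
  have T: "finite ?T" unfolding gap_words_eq_fill[OF step.prems] by simp
  have img: "trunc (Suc k) ` ?P \<subseteq> ?T"
    using step.hyps by (auto simp: trunc_trunc intro!: trunc_in_gap_words[of _ N])
  have "sum (?h k) ?P = (\<Sum>w' \<in> ?T. sum (?h k) {s. s \<in> ?P \<and> trunc (Suc k) s = w'})"
    by (rule sum.group[OF _ T img, symmetric]) simp
  also have "\<dots> = (\<Sum>w' \<in> ?T. value_weight q t e (Suc k) w' *
                       completion_sum q t e N (N - Suc k) (count_list w' 0))"
  proof (intro sum.cong refl)
    fix w' assume w': "w' \<in> ?T"
    \<comment> \<open>The truncation to \<open>Suc k\<close> determines the one to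
      \<open>k\<close>.\<close>
    have eq: "{s. s \<in> ?P \<and> trunc (Suc k) s = w'}
        = {s \<in> permutations_of_set {1..N}. trunc (Suc k) s = w'}"
      using w' trunc_trunc[of k "Suc k"] by auto
    have "sum (?h k) {s. s \<in> ?P \<and> trunc (Suc k) s = w'}
        = (\<Sum>s | s \<in> permutations_of_set {1..N} \<and> trunc (Suc k) s = w'.
             value_weight q t e (Suc k) w' * ?h (Suc k) s)"
      unfolding eq using step.hyps by (intro sum.cong) (auto simp: prod.atLeast_Suc_atMost)
    also have "\<dots> = value_weight q t e (Suc k) w' *
                       completion_sum q t e N (N - Suc k) (count_list w' 0)"
      using step.IH[of w'] w' by (simp flip: sum_distrib_left)
    finally show "sum (?h k) {s. s \<in> ?P \<and> trunc (Suc k) s = w'} = \<dots>" .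
  qed
  also have "\<dots> = completion_sum q t e N (Suc (N - Suc k)) (count_list w 0)"
    using step.hyps by (simp only: sum_successors[OF step.prems] completion_sum.simps) simp
  also have "Suc (N - Suc k) = N - k" using step.hyps by simp
  finally show ?case .
qed

section \<open>From insertions to Motzkin paths\<close>

text \<open>Weighted Motzkin paths with \<open>n\<close> steps from height \<open>h\<close> to 0; two consecutive values
  \<open>2i - 1, 2i\<close> make one step, and height \<open>h\<close> corresponds to \<open>h + 1\<close> gaps.\<close>

fun motzkin :: "'b::comm_ring_1 \<Rightarrow> 'b \<Rightarrow> 'b \<Rightarrow> nat \<Rightarrow> nat \<Rightarrow> 'b" where
  "motzkin q t l 0 h = of_bool (h = 0)"
| "motzkin q t l (Suc n) h = l * (qn q (h + 1))\<^sup>2 * motzkin q t l n h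
     + t * qn q (h + 1) * qn q (h + 2) * motzkin q t l n (h + 1)
     + qn q h * qn q (h + 1) * motzkin q t l n (h - 1)"

text \<open>An odd value changes the height and the even value after it contributes another
  \<open>qn\<close> factor. After \<open>m\<close> such pairs the value \<open>2 * n + 1\<close>
  must close the only remaining gap.\<close>

lemma completion_sum_motzkin:
  "m \<le> n \<Longrightarrow> completion_sum q t e (2 * n + 1) (2 * m + 1) (h + 1) = motzkin q t (1 + t * e) m h"
proof (induction m arbitrary: h)
  case 0
  then show ?case by (cases h) auto
next
  case (Suc m)
  have a: "completion_sum q t e (2 * n + 1) (2 * m + 2) g =
      qn q g * completion_sum q t e (2 * n + 1) (2 * m + 1) g" for g
  proof -
    have "even (2 * n + 1 - (2 * m + 1))" using Suc.prems by simp
    then have "completion_sum q t e (2 * n + 1) (Suc (2 * m + 1)) g =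
      qn q g * completion_sum q t e (2 * n + 1) (2 * m + 1) g"
      by (simp only: completion_sum.simps(2) if_True)
    then show ?thesis by simp
  qed
  have o: "odd (2 * n + 1 - (2 * m + 2))" using Suc.prems by presburger
  \<comment> \<open>At \<open>h = 0\<close> the two last arguments do not correspond, but the factor
    \<open>qn q h\<close> is 0.\<close>
  have d: "qn q h * completion_sum q t e (2 * n + 1) (2 * m + 1) h
      = qn q h * motzkin q t (1 + t * e) m (h - 1)"
    using Suc.IH[of "h - 1"] Suc.prems by (cases h) auto
  have "completion_sum q t e (2 * n + 1) (Suc (2 * m + 2)) (h + 1) = qn q (h + 1) *
      (t * (qn q (h + 2) * completion_sum q t e (2 * n + 1) (2 * m + 1) (h + 2))
      + (1 + t * e) * (qn q (h + 1) * completion_sum q t e (2 * n + 1) (2 * m + 1) (h + 1))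
      + qn q h * completion_sum q t e (2 * n + 1) (2 * m + 1) h)"
    using o by (simp only: completion_sum.simps(2) a) simp
  also have "\<dots> = motzkin q t (1 + t * e) (Suc m) h"
    unfolding d using Suc.IH[of h] Suc.IH[of "h + 1"] Suc.prems
    by (simp add: algebra_simps power2_eq_square)
  finally show ?case by simp
qed

lemma sum_value_weights:
  "(\<Sum>s \<in> permutations_of_set {1..2 * n + 1}.
      \<Prod>j = 1..2 * n + 1. value_weight q t e j (trunc j s)) = motzkin q t (1 + t * e) n 0"
proof -
  have t0: "trunc 0 s = [0]" if "s \<in> permutations_of_set {1..2 * n + 1}" for s
  proof -
    have "set s = {1..2 * n + 1}" using permutations_of_setD[OF that] by simp
    then have "s \<noteq> []" by auto
    moreover have "map (\<lambda>x. if x \<le> 0 then x else 0) s = replicate (length s) 0"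
      by (induction s) auto
    ultimately show ?thesis by (simp add: trunc_def remdups_adj_replicate)
  qed
  \<comment> \<open>Before any insertion there is a single gap, that is, height 0.\<close>
  have "[0] \<in> gap_words 0" by (simp add: gap_words_def)
  from sum_completions[OF _ this, of "2 * n + 1" q t e]
  have "(\<Sum>s | s \<in> permutations_of_set {1..2 * n + 1} \<and> trunc 0 s = [0].
            \<Prod>j = 1..2 * n + 1. value_weight q t e j (trunc j s))
          = completion_sum q t e (2 * n + 1) (2 * n + 1) (0 + 1)"
    by simp
  moreover have "{s \<in> permutations_of_set {1..2 * n + 1}. trunc 0 s = [0]}
      = permutations_of_set {1..2 * n + 1}"
    using t0 by blast
  ultimately show ?thesis by (simp only: completion_sum_motzkin[OF order.refl])
qed

section \<open>Statistics of a permutation in terms of its truncations\<close>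

lemma count_trunc_snoc:
  assumes "0 \<notin> set xs" "x \<noteq> 0"
  shows "count_list (trunc k (xs @ [x])) 0 =
     count_list (trunc k xs) 0 + of_bool (k < x \<and> \<not> (xs \<noteq> [] \<and> k < last xs))"
proof (cases xs rule: rev_cases)
  case Nil
  then show ?thesis using assms by (simp add: trunc_def)
next
  case (snoc ys y)
  then have "y \<noteq> 0" using assms by auto
  then show ?thesis using assms snoc by (auto simp: trunc_def remdups_adj_append_two)
qed

locale perm_word =
  fixes s :: "nat list" and N :: nat
  assumes perm: "s \<in> permutations_of_set {1..N}"
begin

lemma set_s: "set s = {1..N}" and distinct_s: "distinct s"
  using permutations_of_setD[OF perm] by auto

lemma length_s: "length s = N"
  using distinct_card[OF distinct_s] set_s by simp

text \<open>Converts sums and products over values into ones over positions.\<close>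

lemma bij_ent: "bij_betw (ent s) {1..N} {1..N}"
proof (rule bij_betw_byWitness[where f' = "\<lambda>k. Suc (THE j. j < N \<and> s ! j = k)"])
  have the: "(THE j. j < N \<and> s ! j = s ! i) = i" if "i < N" for i
    using that distinct_s length_s by (auto simp: nth_eq_iff_index_eq)
  then show "\<forall>i\<in>{1..N}. Suc (THE j. j < N \<and> s ! j = ent s i) = i"
    by (auto simp: ent_def length_s)
  show "\<forall>k\<in>{1..N}. ent s (Suc (THE j. j < N \<and> s ! j = k)) = k"
  proof
    fix k assume "k \<in> {1..N}"
    then obtain i where "i < N" "k = s ! i"
      using set_s length_s by (metis in_set_conv_nth)
    then show "ent s (Suc (THE j. j < N \<and> s ! j = k)) = k"
      by (simp add: the ent_def length_s)
  qed
  show "ent s ` {1..N} \<subseteq> {1..N}"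
  proof clarify
    fix i assume "i \<in> {1..N}"
    then have "ent s i \<in> set s" by (auto simp: ent_def length_s)
    then show "ent s i \<in> {1..N}" using set_s by simp
  qed
  show "(\<lambda>k. Suc (THE j. j < N \<and> s ! j = k)) ` {1..N} \<subseteq> {1..N}"
  proof clarify
    fix k assume "k \<in> {1..N}"
    then obtain i where "i < N" "k = s ! i"
      using set_s length_s by (metis in_set_conv_nth)
    then show "Suc (THE j. j < N \<and> s ! j = k) \<in> {1..N}"
      by (simp add: the)
  qed
qed

text \<open>\<open>j\<close> may lie outside the word, where the entry is 0 and differs from all
  proper entries.\<close>

lemma ent_eq_iff: "i \<in> {1..N} \<Longrightarrow> ent s i = ent s j \<longleftrightarrow> i = j"
proof
  assume i: "i \<in> {1..N}" and eq: "ent s i = ent s j"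
  then have "ent s i \<noteq> 0" using bij_betwE[OF bij_ent] by fastforce
  then have "j \<in> {1..N}" using eq by (auto simp: ent_def length_s split: if_splits)
  then show "i = j" using i eq bij_ent unfolding bij_betw_def inj_on_def by blast
qed auto

lemma ent_pos: "i \<in> {1..N} \<Longrightarrow> ent s i > 0"
  using bij_betwE[OF bij_ent] by fastforce

lemma ent_outside: "i \<notin> {1..N} \<Longrightarrow> ent s i = 0"
  by (auto simp: ent_def length_s)

text \<open>The exponent of \<open>q\<close> in \<open>value_weight\<close>, expressed by
  positions.\<close>

definition gaps_before :: "nat \<Rightarrow> nat" where
  "gaps_before i = count_list (trunc (ent s i) (take (i - 1) s)) 0 - of_bool (ent s (i - 1) > ent s i)"

lemma take_snoc:
  assumes "m < N"
  shows "take (Suc m) s = take m s @ [ent s (Suc m)]"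
  using assms by (simp add: take_Suc_conv_app_nth ent_def length_s)

text \<open>The convention \<open>ent s 0 = 0\<close> covers the empty prefix.\<close>

lemma last_take: 
  assumes "m \<le> N"
  shows "take m s \<noteq> [] \<and> k < last (take m s) \<longleftrightarrow> k < ent s m"
  using assms length_s by (cases m) (auto simp: take_Suc_conv_app_nth ent_def)

text \<open>In a prefix of the word every block of entries below \<open>k\<close> contributes one more valley than
  peaks, except the first block, which rises from the convention \<open>ent s 0 = 0\<close>, and a last block
  that has not yet passed its final valley.\<close>

lemma crossing_invariant:
  fixes k
  defines "V \<equiv> \<lambda>m. \<Sum>j = 1..m. of_bool (is_valley s j \<and> ent s j < k)"
      and "P \<equiv> \<lambda>m. \<Sum>j = 1..m. of_bool (is_peak s j \<and> ent s j < k)"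
  assumes k: "k > 0" and "m < N" and ne: "\<And>j. j \<le> m \<Longrightarrow> ent s j \<noteq> k"
  shows "int (count_list (trunc k (take m s)) 0) - of_bool (ent s m > k) =
    V m - P m + of_bool (ent s m < k \<and> ent s m > ent s (Suc m))"
  using \<open>m < N\<close> ne
proof (induction m)
  case 0
  then show ?case by (simp add: V_def P_def trunc_def ent_def)
next
  case (Suc m)
  \<comment> \<open>The change from \<open>m\<close> to \<open>Suc m\<close> depends only on how
    these three entries and \<open>k\<close> compare.\<close>
  define a b c where "a = ent s m" and "b = ent s (Suc m)" and "c = ent s (Suc (Suc m))"
  have *: "a \<noteq> b" "b \<noteq> c" "a \<noteq> k" "b \<noteq> k" 
    using ent_eq_iff[of "Suc m" m] ent_eq_iff[of "Suc m" "Suc (Suc m)"] Suc.prems(1)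
      Suc.prems(2)[of m] Suc.prems(2)[of "Suc m"]
    unfolding a_def b_def c_def by auto
  have "0 \<notin> set (take m s)" using set_s set_take_subset[of m s] by auto
  moreover have "b \<noteq> 0" using ent_pos[of "Suc m"] Suc.prems unfolding b_def by simp
  ultimately have cnt: "count_list (trunc k (take (Suc m) s)) 0 =
      count_list (trunc k (take m s)) 0 + of_bool (k < b \<and> \<not> k < a)"
    using Suc.prems(1) last_take[of m k]
    by (subst take_snoc) (simp_all add: count_trunc_snoc a_def b_def)
  have V: "V (Suc m) = V m + of_bool (a > b \<and> b < c \<and> b < k)"
    and P: "P (Suc m) = P m + of_bool (a < b \<and> b > c \<and> b < k)"
    using Suc.prems(1) 
    by (simp_all add: V_def P_def is_valley_def is_peak_def length_s a_def b_def c_def conj_assoc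
        del: sum_of_bool_eq)
  have IH: "int (count_list (trunc k (take m s)) 0) - of_bool (a > k) =
      V m - P m + of_bool (a < k \<and> a > b)"
    using Suc unfolding a_def b_def by simp
  have "int (count_list (trunc k (take (Suc m) s)) 0) - of_bool (b > k) =
    V (Suc m) - P (Suc m) + of_bool (b < k \<and> b > c)"
    unfolding cnt V P using IH * 
    by (cases "a < b"; cases "b < c"; cases "a < k"; cases "b < k") auto
  then show ?case unfolding b_def c_def .
qed

text \<open>This is \<open>crossing_invariant\<close> for the prefix that ends just before the entry
  \<open>k\<close>.\<close>

lemma vcount_minus_pcount:
  assumes i: "i \<in> {1..N}"
  shows "int (vcount s (ent s i)) - int (pcount s (ent s i)) = int (gaps_before i)"
proof -
  define k where "k = ent s i"
  have ex: "(\<exists>i' \<in> {1..length s}. ent s i' = k \<and> j < i') \<longleftrightarrow> j < i" for j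
    using ent_eq_iff[OF i] i unfolding k_def length_s by metis
  have "int (vcount s k) = (\<Sum>j = 1..i-1. of_bool (is_valley s j \<and> ent s j < k))"
    unfolding vcount_def ex 
    by (subst sum_of_bool_eq) (auto simp: is_valley_def intro!: arg_cong[where f = card])
  moreover have "int (pcount s k) = (\<Sum>j = 1..i-1. of_bool (is_peak s j \<and> ent s j < k))"
    unfolding pcount_def ex 
    by (subst sum_of_bool_eq) (auto simp: is_peak_def intro!: arg_cong[where f = card])
  moreover have "ent s j \<noteq> k" if "j \<le> i - 1" for j
    using ent_eq_iff[OF i, of j] that i unfolding k_def by auto
  \<comment> \<open>The entry after the prefix is \<open>k\<close> itself, so the last indicator of
    the invariant is 0.\<close>
  then have "int (count_list (trunc k (take (i - 1) s)) 0) - of_bool (ent s (i - 1) > k) =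
     (\<Sum>j = 1..i-1. of_bool (is_valley s j \<and> ent s j < k)) -
     (\<Sum>j = 1..i-1. of_bool (is_peak s j \<and> ent s j < k)) + 0"
    using crossing_invariant[of k "i - 1"] i ent_pos[OF i] unfolding k_def by auto
  \<comment> \<open>Makes the natural subtraction in \<open>gaps_before\<close> exact.\<close>
  moreover have "0 < count_list (trunc k (take (i - 1) s)) 0" if "ent s (i - 1) > k"
  proof -
    have "i - 1 \<le> N" using i by auto
    then have "take (i - 1) s \<noteq> []" "k < last (take (i - 1) s)"
      using last_take[of "i - 1" k] that by blast+
    then have "0 \<in> (\<lambda>x. if x \<le> k then x else 0) ` set (take (i - 1) s)"
      by (intro image_eqI[of _ _ "last (take (i - 1) s)"]) auto
    then have "0 \<in> set (trunc k (take (i - 1) s))"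
      by (simp add: trunc_def)
    then show ?thesis by (metis count_list_0_iff gr0I)
  qed
  ultimately show ?thesis unfolding gaps_before_def k_def[symmetric] by auto
qed

lemma art_eq: "art s = int (\<Sum>i = 1..N. gaps_before i)"
proof -
  have "art s = (\<Sum>i = 1..N. int (vcount s (ent s i)) - int (pcount s (ent s i)))"
    unfolding art_def length_s by (rule sum.reindex_bij_betw[OF bij_ent, symmetric])
  then show ?thesis by (simp add: vcount_minus_pcount)
qed

text \<open>In the truncation, the letter on either side of \<open>k\<close> is 0 exactly if that
  neighbour in \<open>s\<close> exceeds \<open>k\<close>.\<close>

lemma value_weight_ent:
  assumes i: "i \<in> {1..N}"
  shows "value_weight q t e (ent s i) (trunc (ent s i) s) =
    q ^ gaps_before i * local_weight t e (ent s i) (ent s (i - 1) > ent s i) (ent s (Suc i) > ent s i)"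
proof -
  define k u v where "k = ent s i" and "u = take (i - 1) s" and "v = drop i s"
  have s: "s = u @ k # v"
  proof -
    have "i - 1 < length s" "Suc (i - 1) = i" using i length_s by auto
    then show ?thesis
      using i id_take_nth_drop[of "i - 1" s] by (simp add: u_def v_def k_def ent_def length_s)
  qed
  have kuv: "k \<notin> set u" "k \<notin> set v"
    using distinct_s by (auto simp: s)
  have k: "k > 0" using ent_pos[OF i] by (simp add: k_def)
  have z: "0 \<notin> set s" using set_s by auto
  then have z: "0 \<notin> set u" "0 \<notin> set v" by (auto simp: s)
  have L: "(trunc k u \<noteq> [] \<and> last (trunc k u) = 0) = (ent s (i - 1) > k)"
  proof -
    have "(trunc k u \<noteq> [] \<and> last (trunc k u) = 0) = (u \<noteq> [] \<and> k < last u)"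
      using z(1) by (cases u rule: rev_cases) (auto simp: trunc_def)
    moreover have "i - 1 \<le> N" using i by auto
    ultimately show ?thesis using last_take[of "i - 1" k] unfolding u_def by blast
  qed
  have R: "(trunc k v \<noteq> [] \<and> hd (trunc k v) = 0) = (ent s (Suc i) > k)"
  proof -
    have "(trunc k v \<noteq> [] \<and> hd (trunc k v) = 0) = (v \<noteq> [] \<and> k < hd v)"
      using z(2) by (cases v) (auto simp: trunc_def)
    also have "\<dots> = (ent s (Suc i) > k)"
      using i by (auto simp: v_def ent_def hd_drop_conv_nth length_s)
    finally show ?thesis .
  qed
  have "k \<notin> set (trunc k u)"
    using kuv(1) k by (auto simp: trunc_def)
  then have "value_weight q t e k (trunc k u @ k # trunc k v) =
     q ^ (count_list (trunc k u) 0 - of_bool (ent s (i - 1) > k)) *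
     local_weight t e k (ent s (i - 1) > k) (ent s (Suc i) > k)"
    using value_weight_split[of k "trunc k u" q t e "trunc k v"] by (simp only: L R not_False_eq_True simp_thms)
  moreover have "trunc k s = trunc k u @ k # trunc k v"
    unfolding s by (rule trunc_split) (use kuv k in auto)
  ultimately show ?thesis
    by (simp add: gaps_before_def k_def u_def)
qed

lemma prod_value_weight:
  "(\<Prod>k = 1..N. value_weight q t e k (trunc k s)) = q ^ nat (art s) *
   (\<Prod>i = 1..N. local_weight t e (ent s i) (ent s (i - 1) > ent s i) (ent s (Suc i) > ent s i))"
proof -
  have "(\<Prod>k = 1..N. value_weight q t e k (trunc k s))
      = (\<Prod>i = 1..N. value_weight q t e (ent s i) (trunc (ent s i) s))"
    by (rule prod.reindex_bij_betw[OF bij_ent, symmetric])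
  then show ?thesis
    unfolding art_eq nat_int by (simp add: value_weight_ent prod.distrib power_sum)
qed

text \<open>Descents are indexed here by the lower entry; position 1 adds nothing because
  \<open>ent s 0 = 0\<close>.\<close>

lemma des_eq: "des s = (\<Sum>i = 1..N. of_bool (ent s (i - 1) > ent s i))"
proof -
  have "(\<Sum>i = 1..N. of_bool (ent s (i - 1) > ent s i))
      = card ({1..N} \<inter> {i. ent s (i - 1) > ent s i})"
    by (subst sum_of_bool_eq) auto
  also have "{1..N} \<inter> {i. ent s (i - 1) > ent s i} = Suc ` descents s"
  proof (intro equalityI subsetI)
    fix i assume i: "i \<in> {1..N} \<inter> {i. ent s (i - 1) > ent s i}"
    then have "i - 1 \<noteq> 0" by (metis Int_iff mem_Collect_eq ent_outside atLeastAtMost_iff not_one_le_zero not_less_zero)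
    then have "i - 1 \<in> descents s" "i = Suc (i - 1)"
      using i by (auto simp: descents_def length_s)
    then show "i \<in> Suc ` descents s" by blast
  qed (auto simp: descents_def length_s)
  finally show ?thesis by (simp add: des_def card_image)
qed

lemma card_double_descents:
  "card {i. is_double_descent s i}
    = (\<Sum>i = 1..N. of_bool (ent s (i - 1) > ent s i \<and> \<not> ent s (Suc i) > ent s i))"
proof -
  have "ent s (Suc i) \<noteq> ent s i" if "i \<in> {1..N}" for i
    using ent_eq_iff[OF that, of "Suc i"] by auto
  then have "{i. is_double_descent s i}
      = {1..N} \<inter> {i. ent s (i - 1) > ent s i \<and> \<not> ent s (Suc i) > ent s i}"
    unfolding is_double_descent_def length_s by force
  then show ?thesis by (subst sum_of_bool_eq) auto
qed

text \<open>The first entry of a descent pair is a peak or double descent, the second a valley or double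
  descent, and the last entry is a peak or double descent because of \<open>ent s (Suc N) = 0\<close>.\<close>

lemma even_double_ascent_iff:
  assumes "N > 0"
  shows "odd_odd_desc s \<and> odd (ent s N) \<longleftrightarrow>
   (\<forall>i \<in> {1..N}. even (ent s i) \<longrightarrow> \<not> ent s (i - 1) > ent s i \<and> ent s (Suc i) > ent s i)"
    (is "?A \<longleftrightarrow> ?B")
proof
  assume ?A
  then have A: "\<And>i. i \<in> descents s \<Longrightarrow> odd (ent s i) \<and> odd (ent s (Suc i))" "odd (ent s N)"
    by (auto simp: odd_odd_desc_def)
  show ?B
  proof (intro ballI impI conjI notI)
    fix i assume i: "i \<in> {1..N}" and ev: "even (ent s i)"
    {
      assume d: "ent s (i - 1) > ent s i"
      then have "i - 1 \<in> {1..N}" using ent_outside[of "i - 1"] by fastforce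
      then have "i - 1 \<in> descents s" using d i by (auto simp: descents_def length_s)
      then show False using A(1)[of "i - 1"] i ev by simp
    }
    have "i \<noteq> N" using A ev by auto
    then have "i \<notin> descents s \<Longrightarrow> \<not> ent s i > ent s (Suc i)"
      using i by (auto simp: descents_def length_s)
    moreover have "ent s i \<noteq> ent s (Suc i)" using ent_eq_iff[OF i, of "Suc i"] by simp
    ultimately show "ent s (Suc i) > ent s i" using A(1)[of i] ev by force
  qed
next
  assume B: ?B
  have "odd (ent s N)"
    using B[rule_format, of N] assms ent_outside[of "Suc N"] by auto
  moreover have "odd (ent s i) \<and> odd (ent s (Suc i))" if "i \<in> descents s" for i
    using that B[rule_format, of i] B[rule_format, of "Suc i"] 
    by (auto simp: descents_def length_s)
  ultimately show ?A by (simp add: odd_odd_desc_def)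
qed

text \<open>An even value contributes 1 if it is a double ascent and 0 otherwise, so
  \<open>even_double_ascent_iff\<close> decides whether the product vanishes.\<close>

lemma prod_local_weight:
  assumes "N > 0"
  shows "(\<Prod>i = 1..N. local_weight t e (ent s i) (ent s (i - 1) > ent s i) (ent s (Suc i) > ent s i))
   = (if odd_odd_desc s \<and> odd (ent s N)
      then t ^ des s * e ^ card {i. is_double_descent s i} else 0)"
proof (cases "odd_odd_desc s \<and> odd (ent s N)")
  case True
  then have "(\<Prod>i = 1..N. local_weight t e (ent s i) (ent s (i - 1) > ent s i) (ent s (Suc i) > ent s i))
   = (\<Prod>i = 1..N. t ^ of_bool (ent s (i - 1) > ent s i)
        * e ^ of_bool (ent s (i - 1) > ent s i \<and> \<not> ent s (Suc i) > ent s i))"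
    unfolding even_double_ascent_iff[OF assms]
    by (intro prod.cong refl) (auto simp: local_weight_def)
  also have "\<dots> = t ^ des s * e ^ card {i. is_double_descent s i}"
    by (simp add: prod.distrib des_eq card_double_descents power_sum del: sum_of_bool_eq)
  finally show ?thesis using True by simp
next
  case False
  then obtain i where "i \<in> {1..N}" "even (ent s i)" 
    "\<not> (\<not> ent s (i - 1) > ent s i \<and> ent s (Suc i) > ent s i)"
    unfolding even_double_ascent_iff[OF assms] by blast
  then have "\<exists>i \<in> {1..N}. 
      local_weight t e (ent s i) (ent s (i - 1) > ent s i) (ent s (Suc i) > ent s i) = 0"
    by (intro bexI[of _ i]) (auto simp: local_weight_def)
  then show ?thesis using False by (auto intro!: prod_zero)
qed

end

section \<open>Weighted sums over \<open>Wstar\<close>\<close>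

lemma Wstar_altdef:
  "Wstar n = {s \<in> permutations_of_set {1..2*n+1}. odd_odd_desc s \<and> odd (ent s (2*n+1))}"
  by (auto simp: Wstar_def Wset_def)

text \<open>Source of both claims: \<open>e = 1\<close> gives \<open>Wpoly\<close>, and
  \<open>e = 0\<close> keeps only permutations without double descents.\<close>

lemma Wstar_sum:
  "(\<Sum>s \<in> Wstar n. q ^ nat (art s) * (t ^ des s * e ^ card {i. is_double_descent s i}))
    = motzkin q t (1 + t * e) n 0"
proof -
  have "motzkin q t (1 + t * e) n 0 = (\<Sum>s \<in> permutations_of_set {1..2 * n + 1}.
      if odd_odd_desc s \<and> odd (ent s (2*n+1)) 
      then q ^ nat (art s) * (t ^ des s * e ^ card {i. is_double_descent s i}) else 0)"
    unfolding sum_value_weights[symmetric]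
  proof (intro sum.cong refl)
    fix s assume "s \<in> permutations_of_set {1..2 * n + 1}"
    then interpret perm_word s "2 * n + 1" by unfold_locales
    show "(\<Prod>j = 1..2 * n + 1. value_weight q t e j (trunc j s)) =
      (if odd_odd_desc s \<and> odd (ent s (2*n+1)) 
      then q ^ nat (art s) * (t ^ des s * e ^ card {i. is_double_descent s i}) else 0)"
      unfolding prod_value_weight by (subst prod_local_weight) auto
  qed
  also have "\<dots> = (\<Sum>s \<in> Wstar n. q ^ nat (art s) * (t ^ des s * e ^ card {i. is_double_descent s i}))"
    unfolding Wstar_altdef by (rule sum.inter_filter[symmetric]) simp
  finally show ?thesis ..
qed

text \<open>By \<open>art_eq\<close>, \<open>art\<close> is a sum of natural numbers. Hence
  \<open>powi\<close> is an ordinary power, even for \<open>q = 0\<close>.\<close>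

lemma art_nonneg: "s \<in> Wstar n \<Longrightarrow> art s \<ge> 0"
  using perm_word.art_eq[OF perm_word.intro, of s "2 * n + 1"]
  by (metis (no_types, lifting) Wstar_altdef mem_Collect_eq of_nat_0_le_iff)

text \<open>A descent into the last entry would make that entry a double descent, since a 0 follows
  it.\<close>

lemma primary_iff:
  assumes "n \<ge> 1"
  shows "primary n s \<longleftrightarrow> s \<in> Wstar n \<and> card {i. is_double_descent s i} = 0"
proof (cases "s \<in> Wstar n")
  case True
  then interpret perm_word s "2 * n + 1" by unfold_locales (auto simp: Wstar_altdef)
  have fin: "finite {i. is_double_descent s i}"
    by (rule finite_subset[of _ "{..length s}"]) (auto simp: is_double_descent_def)
  have "ent s (2*n) < ent s (2*n+1)" if "\<not> is_double_descent s (2*n+1)"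
    using that ent_eq_iff[of "2*n+1" "2*n"] ent_outside[of "Suc (2*n+1)"] ent_pos[of "2*n+1"] assms
    by (auto simp: is_double_descent_def length_s)
  then show ?thesis using True fin by (auto simp: primary_def)
qed (auto simp: primary_def)

section \<open>Expansion by the number of up steps\<close>

text \<open>\<open>j\<close> is the number of up steps; the factors \<open>t\<close> and
  \<open>l\<close> are left out.\<close>

fun motzkin_coeff :: "'b::comm_ring_1 \<Rightarrow> nat \<Rightarrow> nat \<Rightarrow> nat \<Rightarrow> 'b" where
  "motzkin_coeff q 0 h j = of_bool (h = 0 \<and> j = 0)"
| "motzkin_coeff q (Suc n) h j = (qn q (h + 1))\<^sup>2 * motzkin_coeff q n h j
     + (if j = 0 then 0 else qn q (h + 1) * qn q (h + 2) * motzkin_coeff q n (h + 1) (j - 1))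
     + qn q h * qn q (h + 1) * motzkin_coeff q n (h - 1) j"

text \<open>A path from \<open>h\<close> to 0 with \<open>j\<close> up steps has
  \<open>h + j\<close> down steps.\<close>

lemma motzkin_coeff_eq_0: "n < h + 2 * j \<Longrightarrow> motzkin_coeff q n h j = 0"
proof (induction n arbitrary: h j)
  case (Suc n)
  have "motzkin_coeff q n h j = 0" using Suc by simp
  moreover have "motzkin_coeff q n (h + 1) (j - 1) = 0" if "j \<noteq> 0"
    using Suc that by (intro Suc.IH) linarith
  moreover have "qn q h * qn q (h + 1) * motzkin_coeff q n (h - 1) j = 0"
    using Suc.IH[of "h - 1" j] Suc.prems by (cases h) auto
  ultimately show ?case by simp
qed auto

text \<open>The \<open>n - h - 2 * j\<close> steps that are neither up nor down are level, each with
  a factor \<open>l\<close>. A bound \<open>J\<close> independent of \<open>n\<close> survives the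
  induction.\<close>

lemma motzkin_expand:
  "n \<le> J \<Longrightarrow> motzkin q t l n h = (\<Sum>j\<le>J. motzkin_coeff q n h j * t ^ j * l ^ (n - h - 2 * j))"
proof (induction n arbitrary: h)
  case 0
  have "(\<Sum>j\<le>J. motzkin_coeff q 0 h j * t ^ j * l ^ (0 - h - 2 * j))
      = (\<Sum>j\<le>J. if j = 0 then of_bool (h = 0) else 0)"
    by (intro sum.cong) auto
  then show ?case by simp
next
  case (Suc n)
  let ?c = "motzkin_coeff q n"
  have level: "l * motzkin q t l n h = (\<Sum>j\<le>J. ?c h j * t ^ j * l ^ (Suc n - h - 2 * j))"
  proof -
    have "l * (?c h j * t ^ j * l ^ (n - h - 2 * j)) = ?c h j * t ^ j * l ^ (Suc n - h - 2 * j)" for j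
    \<comment> \<open>Where the exponent would be truncated, the coefficient is 0.\<close>
    proof (cases "n < h + 2 * j")
      case False
      then have "Suc n - h - 2 * j = Suc (n - h - 2 * j)" by simp
      then show ?thesis by simp
    qed (simp add: motzkin_coeff_eq_0)
    then show ?thesis using Suc by (simp add: sum_distrib_left)
  qed
  have up: "t * motzkin q t l n (h + 1)
      = (\<Sum>j\<le>J. (if j = 0 then 0 else ?c (h + 1) (j - 1)) * t ^ j * l ^ (Suc n - h - 2 * j))"
  proof (cases J)
    case (Suc K)
    \<comment> \<open>Dropping the top term makes room for the index shift caused by the factor
      \<open>t\<close>.\<close>
    have "?c (h + 1) J = 0" using Suc.prems by (intro motzkin_coeff_eq_0) simp
    then have "t * motzkin q t l n (h + 1) = (\<Sum>j\<le>K. t * (?c (h + 1) j * t ^ j * l ^ (n - (h + 1) - 2 * j)))"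
      using Suc.IH[of "h + 1"] Suc.prems Suc by (simp add: sum_distrib_left algebra_simps)
    then show ?thesis unfolding Suc sum.atMost_Suc_shift by (simp add: algebra_simps)
  qed (use Suc.prems in simp)
  have down: "qn q h * motzkin q t l n (h - 1)
      = (\<Sum>j\<le>J. qn q h * ?c (h - 1) j * t ^ j * l ^ (Suc n - h - 2 * j))"
  proof (cases h)
    case (Suc h')
    then show ?thesis using Suc.IH[of h'] Suc.prems by (simp add: sum_distrib_left mult.assoc)
  qed simp
  have "motzkin q t l (Suc n) h = (qn q (h + 1))\<^sup>2 * (l * motzkin q t l n h)
     + qn q (h + 1) * qn q (h + 2) * (t * motzkin q t l n (h + 1))
     + qn q (h + 1) * (qn q h * motzkin q t l n (h - 1))"
    by (simp add: algebra_simps)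
  also have "\<dots> = (\<Sum>j\<le>J. motzkin_coeff q (Suc n) h j * t ^ j * l ^ (Suc n - h - 2 * j))"
    unfolding level up down sum_distrib_left sum.distrib[symmetric]
    by (intro sum.cong) (auto simp: algebra_simps)
  finally show ?case .
qed

text \<open>Used with \<open>l = 1 + t\<close> for the first claim and with \<open>l = 1\<close> for
  the continued fraction.\<close>

lemma motzkin_expand_div2:
  "motzkin q t l n 0 = (\<Sum>j = 0..n div 2. motzkin_coeff q n 0 j * t ^ j * l ^ (n - 2 * j))"
  unfolding motzkin_expand[OF order.refl]
  by (rule sum.mono_neutral_cong_right) (auto simp: motzkin_coeff_eq_0)

lemma qn_fps_const: "qn (fps_const q) k = fps_const (qn q k)"
  by (induction k) (auto simp: qn_Suc simp flip: fps_const_add)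

text \<open>With level weight 1, the power of \<open>fps_X\<close> counts exactly the up
  steps.\<close>

lemma fps_nth_motzkin:
  fixes q :: "'a::field"
  shows "fps_nth (motzkin (fps_const q) fps_X 1 n h) j = motzkin_coeff q n h j"
proof (induction n arbitrary: h j)
  case (Suc n)
  show ?case
    by (simp add: Suc qn_fps_const mult.assoc fps_const_power[symmetric] del: fps_const_power)
      (simp add: Suc flip: mult.assoc)
qed simp

text \<open>Marking descents by \<open>fps_X\<close> separates the numbers of descents, and weight 0 for
  double descents leaves only the primary permutations.\<close>

lemma gam_eq:
  assumes "n \<ge> 1"
  shows "gam q n j = motzkin_coeff q n 0 j"
proof -
  let ?dd = "\<lambda>s. card {i. is_double_descent s i}"
  have fin: "finite (Wstar n)" by (simp add: Wstar_altdef)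
  have "motzkin_coeff q n 0 j = (\<Sum>s \<in> Wstar n. 
      fps_nth (fps_const q ^ nat (art s) * (fps_X ^ des s * 0 ^ ?dd s)) j)"
    using Wstar_sum[where q = "fps_const q" and n = n and t = fps_X and e = 0]
    unfolding fps_nth_motzkin[symmetric] fps_sum_nth[symmetric] by simp
  also have "\<dots> = (\<Sum>s \<in> Wstar n. if primary n s \<and> des s = j then q powi art s else 0)"
  proof (intro sum.cong refl)
    fix s assume s: "s \<in> Wstar n"
    then have "q powi art s = q ^ nat (art s)"
      using art_nonneg[OF s] by (simp add: power_int_def)
    then show "fps_nth (fps_const q ^ nat (art s) * (fps_X ^ des s * 0 ^ ?dd s)) j
       = (if primary n s \<and> des s = j then q powi art s else 0)"
      using s primary_iff[OF assms, of s] by (auto simp: power_0_left)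
  qed
  also have "\<dots> = gam q n j"
    unfolding gam_def by (rule sum.inter_filter[OF fin, symmetric])
  finally show ?thesis ..
qed

lemma Wpoly_eq: "Wpoly q t n = motzkin q t (1 + t) n 0"
proof -
  have "q powi art s = q ^ nat (art s)" if "s \<in> Wstar n" for s
    using art_nonneg[OF that] by (simp add: power_int_def)
  then show ?thesis
    using Wstar_sum[where q = q and n = n and t = t and e = 1] by (simp add: Wpoly_def)
qed

section \<open>The continued fraction\<close>

lemma qint_eq_qn: "qint q k = qn q k"
  by (simp add: qint_def qn_def)

text \<open>For large \<open>D\<close>, an approximation of the generating function of weighted Motzkin paths
  from height \<open>h\<close> to 0, decomposed at the first visits to the heights \<open>h, h - 1, \<dots>, 0\<close>.\<close>

fun partial_fps :: "'a::field \<Rightarrow> 'a \<Rightarrow> nat \<Rightarrow> nat \<Rightarrow> 'a fps" where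
  "partial_fps q t D 0 = cfrac q t 0 D"
| "partial_fps q t D (Suc h) = fps_X * fps_const (qn q (h + 1) * qn q (h + 2))
     * cfrac q t (Suc h) (D - Suc h) * partial_fps q t D h"

text \<open>The denominator has constant term 1 and is therefore invertible.\<close>

lemma cfrac_unfold:
  "cfrac q t h (Suc d) * (1 - fps_const (mu q h) * fps_X
     - fps_const (lam q t (Suc h)) * fps_X ^ 2 * cfrac q t (Suc h) d) = 1"
  unfolding cfrac.simps by (rule inverse_mult_eq_1) simp

text \<open>This is the recursion of \<open>motzkin\<close> by the first step, for
  \<open>l = 1\<close>, in terms of generating functions.\<close>

lemma partial_fps_rec:
  assumes "h < D"
  shows "partial_fps q t D h = of_bool (h = 0) + fps_X * (fps_const (mu q h) * partial_fps q t D h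
     + fps_const (t * qn q (h + 1) * qn q (h + 2)) * partial_fps q t D (h + 1)
     + fps_const (qn q h * qn q (h + 1)) * partial_fps q t D (h - 1))"
proof -
  define J where "J = cfrac q t h (D - h)"
  define J' where "J' = cfrac q t (Suc h) (D - Suc h)"
  define P where "P = partial_fps q t D h"
  have J: "J * (1 - fps_const (mu q h) * fps_X - fps_const (lam q t (Suc h)) * fps_X ^ 2 * J') = 1"
    using cfrac_unfold[of q t h "D - Suc h"] assms by (simp add: J_def J'_def Suc_diff_Suc)
  \<comment> \<open>The weight of an up step from \<open>h\<close> times that of the down step back
    to \<open>h\<close>.\<close>
  have lam: "fps_const (lam q t (Suc h)) = fps_const (t * qn q (h + 1) * qn q (h + 2))
      * fps_const (qn q (h + 1) * qn q (h + 2))"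
    by (simp add: lam_def qint_eq_qn power2_eq_square algebra_simps)
  let ?c = "fps_const (t * qn q (h + 1) * qn q (h + 2))"
  let ?d = "fps_const (qn q (h + 1) * qn q (h + 2))"
  let ?B = "of_bool (h = 0) + fps_X * (fps_const (qn q h * qn q (h + 1)) * partial_fps q t D (h - 1))"
  \<comment> \<open>\<open>P\<close> contains the factor \<open>J\<close>, which cancels against the
    denominator by \<open>J\<close>'s equation.\<close>
  have B: "P * (1 - fps_const (mu q h) * fps_X - ?c * ?d * fps_X ^ 2 * J') = ?B"
  proof (cases h)
    case 0
    then show ?thesis using J unfolding lam by (simp add: P_def J_def)
  next
    case (Suc h')
    then have "P = fps_X * (fps_const (qn q h * qn q (h + 1)) * partial_fps q t D (h - 1)) * J"
      by (simp add: P_def J_def algebra_simps)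
    then show ?thesis using J Suc unfolding lam by (simp add: mult.assoc)
  qed
  have "partial_fps q t D (h + 1) = fps_X * ?d * J' * P"
    by (simp add: J'_def P_def)
  moreover have "P = P * (1 - fps_const (mu q h) * fps_X - c * d * fps_X ^ 2 * J')
      + fps_X * (fps_const (mu q h) * P + c * (fps_X * d * J' * P))" for c d
    by (simp add: algebra_simps power2_eq_square)
  ultimately have "P = ?B + fps_X * (fps_const (mu q h) * P + ?c * partial_fps q t D (h + 1))"
    using B by metis
  then show ?thesis
    unfolding P_def by (simp only: distrib_left add_ac)
qed

text \<open>Each step lowers \<open>n\<close> by one and raises \<open>h\<close> by at most one, so
  \<open>n + h < D\<close> persists and depth \<open>D\<close> suffices.\<close>

lemma nth_partial_fps:
  "n + h < D \<Longrightarrow> fps_nth (partial_fps q t D h) n = motzkin q t 1 n h"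
proof (induction n arbitrary: h)
  case 0
  then show ?case by (subst partial_fps_rec) auto
next
  case (Suc n)
  then show ?case
    by (subst partial_fps_rec) (simp_all add: mu_def qint_eq_qn del: partial_fps.simps)
qed

theorem mainTheorem2:
  fixes q t :: "'a::field"
  shows "(\<forall>n \<ge> 1. Wpoly q t n =
            (\<Sum>j = 0..n div 2. gam q n j * t ^ j * (1 + t) ^ (n - 2*j)))
       \<and> ((\<lambda>d. cfrac q t 0 d) \<longlonglongrightarrow>
            Abs_fps (\<lambda>n. if n = 0 then 1 else \<Sum>j = 0..n div 2. gam q n j * t ^ j))"
proof (intro conjI allI impI)
  fix n :: nat assume "n \<ge> 1"
  then show "Wpoly q t n = (\<Sum>j = 0..n div 2. gam q n j * t ^ j * (1 + t) ^ (n - 2*j))"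
    unfolding Wpoly_eq motzkin_expand_div2 by (simp add: gam_eq)
next
  let ?G = "Abs_fps (\<lambda>n. if n = 0 then 1 else \<Sum>j = 0..n div 2. gam q n j * t ^ j)"
  \<comment> \<open>Coefficient \<open>n\<close> is final from depth \<open>n + 1\<close> on; at
    \<open>n = 0\<close> it is 1, in accordance with the convention for the empty case.\<close>
  have nth: "fps_nth (cfrac q t 0 d) n = fps_nth ?G n" if "n < d" for n d
    using nth_partial_fps[of n 0 d q t] that by (simp add: motzkin_expand_div2 gam_eq)
  show "(\<lambda>d. cfrac q t 0 d) \<longlonglongrightarrow> ?G"
  proof (rule tendsto_fpsI)
    fix n
    show "\<forall>\<^sub>F d in sequentially. fps_nth (cfrac q t 0 d) n = fps_nth ?G n"
      using eventually_gt_at_top[of n] by eventually_elim (rule nth)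
  qed
qed

end
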